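(* Let $F$ be a set of Borel measurable functions $f : [0,1] \rightarrow \mathbb{R}$. If $F$ is permutation closed and $f \in F$, then $f$ is constant almost everywhere with respect to Lebesgue measure on $[0,1]$; that is, there exists $c \in \mathbb{R}$ such that the set $\{x \in [0,1] : f(x) \neq c\}$ has Lebesgue measure zero.
   Context: A permutation of $[0,1]$ is an arbitrary bijection $\sigma : [0,1] \rightarrow [0,1]$ (no measurability or continuity is required of $\sigma$). A set $F$ of functions from $[0,1]$ to $\mathbb{R}$ is called permutation closed if for every $f \in F$ and every permutation $\sigma$ of $[0,1]$, the composition $f \circ \sigma$ belongs to $F$. *)

theory Defs
  imports "HOL-Analysis.Analysis"
begin

text \<open>
  Functions from \<open>[0,1]\<close> to the reals are elements of \<open>{0..1} \<rightarrow>\<^sub>E UNIV\<close>, i.e. HOL functions that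
  take the fixed value \<open>undefined\<close> outside \<open>{0..1}\<close>. Hence equality and set membership of such
  functions depend only on their values on \<open>[0,1]\<close>; \<open>compose {0..1} f \<sigma>\<close> is \<open>f \<circ> \<sigma>\<close> as a function
  on \<open>[0,1]\<close>.
\<close>

definition interval_permutation :: "(real \<Rightarrow> real) \<Rightarrow> bool" where
  "interval_permutation \<sigma> \<longleftrightarrow> bij_betw \<sigma> {0..1} {0..1}"

definition permutation_closed :: "(real \<Rightarrow> real) set \<Rightarrow> bool" where
  "permutation_closed F \<longleftrightarrow>
     (\<forall>f\<in>F. \<forall>\<sigma>. interval_permutation \<sigma> \<longrightarrow> compose {0..1} f \<sigma> \<in> F)"

end

theory Submission
  imports Defs
begin

text \<open>
  If \<open>f\<close> is not almost everywhere constant, some sublevel set \<open>A = {f \<le> t}\<close> and its complement in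
  \<open>[0,1]\<close> both have positive measure, hence both have the cardinality of the continuum: for compact
  \<open>K\<close> of positive measure, \<open>x \<mapsto> |K \<inter> {..x}|\<close> is continuous and takes all its positive values on \<open>K\<close>. Take a
  non-measurable \<open>N \<subseteq> [0,1]\<close> such that \<open>N\<close> and its complement each contain an interval.
  A permutation carrying \<open>N\<close> onto \<open>A\<close> makes \<open>N\<close> a sublevel set of \<open>f \<circ> \<sigma>\<close>, which is then not Borel.
\<close>

text \<open>Vitali's construction: \<open>N\<close> holds one representative in
  \<open>{a..b}\<close> of each coset of the rationals. Positive measure fails because infinitely
  many disjoint translates fit into a bounded interval, measure zero because countably many
  translates cover the line.\<close>

lemma exists_not_lebesgue_subset_interval:
  fixes a b :: real
  assumes "a < b"
  obtains N where "N \<subseteq> {a..b}" "N \<notin> sets lebesgue"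
proof -
  define r where "r x = (SOME y. y \<in> {a..b} \<and> y - x \<in> \<rat>)" for x :: real
  define N where "N = range r"
  have r: "r x \<in> {a..b} \<and> r x - x \<in> \<rat>" for x
  proof -
    obtain q where "q \<in> \<rat>" "a - x < q" "q < b - x"
      using Rats_dense_in_real[of "a - x" "b - x"] assms by auto
    then have "x + q \<in> {a..b} \<and> (x + q) - x \<in> \<rat>"
      by auto
    then show ?thesis
      unfolding r_def by (rule someI)
  qed
  \<comment> \<open>For points of one coset the predicates under \<open>SOME\<close> are equal, so
    the same representative is chosen.\<close>
  have r_eq: "r x = r y" if "x - y \<in> \<rat>" for x y
  proof -
    have "z - x \<in> \<rat> \<longleftrightarrow> z - y \<in> \<rat>" for z
      using Rats_add[OF _ that, of "z - x"] Rats_diff[OF _ that, of "z - y"] by auto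
    then show ?thesis
      by (simp add: r_def)
  qed
  have "N \<subseteq> {a..b}"
    using r by (auto simp: N_def)
  moreover have "N \<notin> sets lebesgue"
  proof
    assume "N \<in> sets lebesgue"
    then have N: "N \<in> lmeasurable"
      using \<open>N \<subseteq> {a..b}\<close> by (meson bounded_closed_interval bounded_set_imp_lmeasurable bounded_subset)
    have "measure lebesgue N = 0"
    proof (rule ccontr)
      assume "measure lebesgue N \<noteq> 0"
      then have pos: "measure lebesgue N > 0"
        by (simp add: zero_less_measure_iff)
      \<comment> \<open>Distinct rational shifts make the translates disjoint, since
        \<open>N\<close> meets each coset once; as the shifts lie between 0 and 1, all translates
        stay inside \<open>{a..b + 1}\<close>.\<close>
      define T where "T n = (+) (1 / real (Suc n)) ` N" for n
      have disj: "disjoint_family T"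
        unfolding disjoint_family_on_def
      proof (intro ballI impI equals0I)
        fix m n z
        assume "m \<noteq> n" "z \<in> T m \<inter> T n"
        then obtain x y where xy: "1 / real (Suc m) + r x = 1 / real (Suc n) + r y"
          by (auto simp: T_def N_def)
        then have "r x - r y \<in> \<rat>"
        proof -
          have "r x - r y = 1 / real (Suc n) - 1 / real (Suc m)"
            using xy by simp
          then show ?thesis
            by (metis Rats_1 Rats_diff Rats_divide Rats_of_nat)
        qed
        moreover have "x - y = (r x - r y) - (r x - x) + (r y - y)"
          by simp
        ultimately have "x - y \<in> \<rat>"
          using r Rats_add Rats_diff by metis
        then have "r x = r y"
          by (rule r_eq)
        with xy \<open>m \<noteq> n\<close> show False
          by simp
      qed
      have Tm: "T n \<in> lmeasurable" for n
        unfolding T_def by (rule measurable_translation[OF N])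
      have bound: "real k * measure lebesgue N \<le> b - a + 1" for k
      proof -
        have "real k * measure lebesgue N = (\<Sum>n<k. measure lebesgue (T n))"
          by (simp add: T_def measure_translation)
        also have "\<dots> = measure lebesgue (\<Union>n<k. T n)"
        proof (rule measure_UNION'[symmetric])
          show "pairwise (\<lambda>i j. disjnt (T i) (T j)) {..<k}"
            using disj by (auto simp: disjoint_family_on_def pairwise_def disjnt_def)
        qed (use Tm in auto)
        also have "\<dots> \<le> measure lebesgue {a..b + 1}"
        proof (rule measure_mono_fmeasurable)
          show "(\<Union>n<k. T n) \<subseteq> {a..b + 1}"
          proof
            fix z assume "z \<in> (\<Union>n<k. T n)"
            then obtain n x where "x \<in> N" "z = 1 / real (Suc n) + x"
              by (auto simp: T_def)
            moreover from this have "a \<le> x" "x \<le> b"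
              using \<open>N \<subseteq> {a..b}\<close> by auto
            moreover have "0 \<le> 1 / real (Suc n)" "1 / real (Suc n) \<le> 1"
              by auto
            ultimately show "z \<in> {a..b + 1}"
              unfolding atLeastAtMost_iff by linarith
          qed
        qed (use Tm in \<open>auto intro!: fmeasurableD\<close>)
        finally show ?thesis
          using assms by simp
      qed
      obtain k :: nat where "b - a + 1 < real k * measure lebesgue N"
        using reals_Archimedean3[OF pos] by blast
      with bound[of k] show False
        by simp
    qed
    then have "negligible N"
      using N negligible_iff_measure by blast
    then have "negligible (\<Union>q\<in>\<rat>. (+) q ` N)"
      by (intro negligible_countable_Union countable_image countable_rat)
         (auto intro: negligible_translation)
    moreover have "(\<Union>q\<in>\<rat>. (+) q ` N) = UNIV"
    proof -
      have "x \<in> (\<Union>q\<in>\<rat>. (+) q ` N)" for x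
      proof (intro UN_I image_eqI)
        \<comment> \<open>Every \<open>x\<close> is reached from its representative
          \<open>r x\<close> by the rational shift \<open>x - r x\<close>.\<close>
        show "- (r x - x) \<in> \<rat>"
          using r Rats_minus_iff by blast
      qed (auto simp: N_def)
      then show ?thesis
        by blast
    qed
    ultimately show False
      by simp
  qed
  ultimately show thesis
    by (rule that)
qed

text \<open>Inner regularity reduces the claim to a compact \<open>K\<close> of measure
  \<open>m > 0\<close>. Its distribution function \<open>g\<close> maps \<open>K\<close> onto a set
  containing \<open>{0<..<m}\<close>, an interval equipollent to the reals.\<close>

lemma reals_lepoll_bounded_lmeasurable:
  fixes S :: "real set"
  assumes S: "S \<in> lmeasurable" and bounded: "bounded S" and pos: "0 < measure lebesgue S"
  shows "(UNIV :: real set) \<lesssim> S"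
proof -
  \<comment> \<open>Allowing an error just below the whole measure of \<open>S\<close> is enough to
    leave \<open>K\<close> with positive measure.\<close>
  obtain K where K: "closed K" "K \<subseteq> S" "S - K \<in> lmeasurable"
    "emeasure lebesgue (S - K) < ennreal (measure lebesgue S)"
    using sets_lebesgue_inner_closed[OF fmeasurableD[OF S] pos] by blast
  have "compact K"
    using K(1,2) bounded by (meson bounded_subset compact_eq_bounded_closed)
  then have Kmeas: "K \<in> lmeasurable"
    by (rule lmeasurable_compact)
  have "measure lebesgue S - measure lebesgue K = measure lebesgue (S - K)"
    using measurable_measure_Diff[OF S fmeasurableD[OF Kmeas] K(2)] by simp
  also have "\<dots> < measure lebesgue S"
    using K(3,4) pos by (simp add: emeasure_eq_measure2 ennreal_less_iff)
  finally have Kpos: "0 < measure lebesgue K"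
    by simp
  define m where "m = measure lebesgue K"
  have m: "0 < m"
    using Kpos by (simp add: m_def)
  have Km: "K \<inter> {..x} \<in> lmeasurable" "compact (K \<inter> {..x})" for x
    using \<open>compact K\<close> by (auto intro: lmeasurable_compact compact_Int_closed)
  define g where "g x = measure lebesgue (K \<inter> {..x})" for x
  \<comment> \<open>Moving from \<open>x\<close> to \<open>y\<close> adds at most the part of
    \<open>K\<close> inside \<open>{x..y}\<close>; so \<open>g\<close> is 1-Lipschitz.\<close>
  have g_lip: "g y \<le> g x + (y - x)" if "x \<le> y" for x y
  proof -
    have "g y \<le> measure lebesgue ((K \<inter> {..x}) \<union> {x..y})"
      unfolding g_def using Km by (intro measure_mono_fmeasurable) (auto intro: fmeasurableD)
    also have "\<dots> \<le> g x + measure lebesgue {x..y}"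
      unfolding g_def using Km by (intro measure_Un_le) (auto intro: fmeasurableD)
    finally show ?thesis
      using that by simp
  qed
  have g_mono: "g x \<le> g y" if "x \<le> y" for x y
    unfolding g_def using Km that by (intro measure_mono_fmeasurable) (auto intro: fmeasurableD)
  have "dist (g x) (g y) \<le> 1 * dist x y" for x y
    using g_lip[of x y] g_lip[of y x] g_mono[of x y] g_mono[of y x]
    by (auto simp: dist_real_def abs_if)
  then have cont: "continuous_on A g" for A
    by (intro lipschitz_on_continuous_on[of 1] lipschitz_onI) auto
  obtain a b where ab: "K \<subseteq> {a..b}"
    using compact_imp_bounded[OF \<open>compact K\<close>] bounded_subset_cbox_symmetric[of K] by (metis interval_cbox)
  have "K \<noteq> {}"
    using m by (auto simp: m_def)
  with ab have "a \<le> b"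
    by fastforce
  \<comment> \<open>Starting at \<open>a - 1\<close> instead of \<open>a\<close> keeps the cut empty
    even when \<open>a\<close> lies in \<open>K\<close>.\<close>
  have "K \<inter> {..a - 1} = {}" "K \<inter> {..b} = K"
    using ab by fastforce+
  then have "g (a - 1) = 0" "g b = m"
    by (simp_all add: g_def m_def)
  have "{0<..<m} \<subseteq> g ` K"
  proof
    fix y assume y: "y \<in> {0<..<m}"
    then obtain x where x: "g x = y"
      using IVT'[of g "a - 1" y b] cont \<open>g (a - 1) = 0\<close> \<open>g b = m\<close> \<open>a \<le> b\<close> by auto
    \<comment> \<open>The point \<open>x\<close> from the intermediate value theorem may lie outside
      \<open>K\<close>. As \<open>y > 0\<close>, the cut at \<open>x\<close> is nonempty, and its
      largest element \<open>s\<close> belongs to \<open>K\<close> and cuts off the same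
      set.\<close>
    have "K \<inter> {..x} \<noteq> {}"
      using y x by (auto simp: g_def)
    then obtain s where s: "s \<in> K \<inter> {..x}" "\<And>t. t \<in> K \<inter> {..x} \<Longrightarrow> t \<le> s"
      using compact_attains_sup[OF Km(2)] by blast
    then have "K \<inter> {..s} = K \<inter> {..x}"
      by fastforce
    then have "g s = y"
      using x by (simp add: g_def)
    then show "y \<in> g ` K"
      using s by blast
  qed
  then have "{0<..<m} \<lesssim> K"
    by (rule subset_image_lepoll)
  moreover have "(UNIV :: real set) \<lesssim> {0<..<m}"
    using m by (meson eqpoll_imp_lepoll eqpoll_sym open_interval_eqpoll_reals)
  ultimately show ?thesis
    using K(2) by (meson lepoll_trans subset_imp_lepoll)
qed

text \<open>The constant is the infimum of the levels \<open>t\<close> above which \<open>f\<close>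
  lies only on a null set. By the dichotomy, the lower sets below that infimum are null as
  well.\<close>

lemma constant_AE_if_cuts_null:
  fixes f :: "'a \<Rightarrow> real"
  assumes S: "S \<notin> null_sets M"
    and cut: "\<And>t. {x \<in> S. f x \<le> t} \<in> null_sets M \<or> {x \<in> S. t < f x} \<in> null_sets M"
  obtains c where "{x \<in> S. f x \<noteq> c} \<in> null_sets M"
proof -
  define L where "L t = {x \<in> S. f x \<le> t}" for t
  define G where "G t = {x \<in> S. t < f x}" for t
  define U where "U = {t. G t \<in> null_sets M}"
  \<comment> \<open>Null sets are measurable by definition and \<open>M\<close> may be incomplete,
    so \<open>G t \<subseteq> G s\<close> alone does not suffice. Instead, a null \<open>L t\<close>
    together with the null \<open>G s\<close> would make \<open>S\<close> null.\<close>
  have up: "t \<in> U" if "s \<in> U" "s \<le> t" for s t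
  proof (cases "L t \<in> null_sets M")
    case True
    have "S = L t \<union> G s"
      using that by (auto simp: L_def G_def)
    with True that S show ?thesis
      by (auto simp: U_def)
  next
    case False
    then show ?thesis
      using cut[of t] by (auto simp: L_def G_def U_def)
  qed
  \<comment> \<open>An empty \<open>U\<close> would cover \<open>S\<close> by the null sets
    \<open>L n\<close>, a \<open>U\<close> unbounded below by the null sets \<open>G (- n)\<close>;
    hence \<open>Inf U\<close> is meaningful.\<close>
  have "U \<noteq> {}"
  proof
    assume "U = {}"
    then have "L t \<in> null_sets M" for t
      using cut[of t] by (auto simp: L_def G_def U_def)
    then have "(\<Union>n. L (real n)) \<in> null_sets M"
      by auto
    also have "(\<Union>n. L (real n)) = S"
      using real_arch_simple by (auto simp: L_def)
    finally show False
      using S by simp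
  qed
  have "bdd_below U"
  proof (rule ccontr)
    assume "\<not> bdd_below U"
    then have "t \<in> U" for t
      using up by (meson bdd_below.I linear)
    then have "(\<Union>n. G (- real n)) \<in> null_sets M"
      by (auto simp: U_def)
    also have "(\<Union>n. G (- real n)) = S"
    proof -
      have "\<exists>n. - real n < f x" for x
        using reals_Archimedean2[of "- f x"] by (auto simp: minus_less_iff)
      then show ?thesis
        by (auto simp: G_def)
    qed
    finally show False
      using S by simp
  qed
  define c where "c = Inf U"
  have above: "G t \<in> null_sets M" if "c < t" for t
    using that up \<open>U \<noteq> {}\<close> \<open>bdd_below U\<close> unfolding c_def U_def
    by (metis (mono_tags, lifting) U_def cInf_less_iff less_imp_le mem_Collect_eq)
  have below: "L t \<in> null_sets M" if "t < c" for t
  proof -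
    have "t \<notin> U"
      using that cInf_lower[OF _ \<open>bdd_below U\<close>, of t] by (auto simp: c_def)
    then show ?thesis
      using cut[of t] by (auto simp: L_def G_def U_def)
  qed
  \<comment> \<open>A rational strictly between \<open>c\<close> and \<open>f x\<close> witnesses
    \<open>f x \<noteq> c\<close>, so countably many levels suffice.\<close>
  have "(\<Union>q\<in>\<rat> \<inter> {c<..}. G q) \<union> (\<Union>q\<in>\<rat> \<inter> {..<c}. L q) \<in> null_sets M"
    using above below
    by (intro null_sets.Un null_sets_UN' countable_Int1 countable_rat) auto
  also have "(\<Union>q\<in>\<rat> \<inter> {c<..}. G q) \<union> (\<Union>q\<in>\<rat> \<inter> {..<c}. L q) = {x \<in> S. f x \<noteq> c}" (is "?A = ?B")
  proof
    show "?A \<subseteq> ?B"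
      by (auto simp: L_def G_def)
    show "?B \<subseteq> ?A"
    proof
      fix x assume x: "x \<in> ?B"
      show "x \<in> ?A"
      proof (cases "c < f x")
        case True
        then obtain q where "q \<in> \<rat>" "c < q" "q < f x"
          using Rats_dense_in_real by blast
        with x show ?thesis
          by (auto simp: G_def)
      next
        case False
        then obtain q where "q \<in> \<rat>" "f x < q" "q < c"
          using Rats_dense_in_real[of "f x" c] x by auto
        with x show ?thesis
          by (auto simp: L_def intro!: bexI[of _ q])
      qed
    qed
  qed
  finally show thesis
    by (rule that)
qed

text \<open>Gluing two bijections of disjoint parts prescribes the preimage of \<open>B\<close>;
  this is how a sublevel set of \<open>f\<close> is pulled back to a chosen set.\<close>

lemma bij_betw_if_eqpoll_parts:
  assumes "A \<approx> B" "C \<approx> D" "A \<inter> C = {}" "B \<inter> D = {}"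
  obtains \<sigma> where "bij_betw \<sigma> (A \<union> C) (B \<union> D)" "\<And>x. x \<in> A \<union> C \<Longrightarrow> \<sigma> x \<in> B \<longleftrightarrow> x \<in> A"
proof -
  obtain g h where g: "bij_betw g A B" and h: "bij_betw h C D"
    using assms by (auto simp: eqpoll_def)
  define \<sigma> where "\<sigma> x = (if x \<in> A then g x else h x)" for x
  have gA: "bij_betw \<sigma> A B"
    using g by (simp add: \<sigma>_def cong: bij_betw_cong)
  have hC: "bij_betw \<sigma> C D"
  proof -
    have "\<sigma> x = h x" if "x \<in> C" for x
      using that assms(3) by (auto simp: \<sigma>_def)
    then show ?thesis
      using h by (simp cong: bij_betw_cong)
  qed
  show thesis
  proof
    show "bij_betw \<sigma> (A \<union> C) (B \<union> D)"
      using gA hC assms(4) by (rule bij_betw_combine)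
    show "\<sigma> x \<in> B \<longleftrightarrow> x \<in> A" if "x \<in> A \<union> C" for x
      using that bij_betwE[OF gA] bij_betwE[OF hC] assms(4) by blast
  qed
qed

theorem theorem1:
  fixes F :: "(real \<Rightarrow> real) set" and f :: "real \<Rightarrow> real"
  assumes "F \<subseteq> {0..1} \<rightarrow>\<^sub>E UNIV"
    and "\<And>g. g \<in> F \<Longrightarrow> g \<in> borel_measurable (restrict_space borel {0..1})"
    and "permutation_closed F"
    and "f \<in> F"
  shows "\<exists>c::real. {x \<in> {0..1}. f x \<noteq> c} \<in> null_sets lebesgue"
proof -
  have sublevel: "{x \<in> {0..1}. g x \<le> t} \<in> sets borel" if "g \<in> F" for g t
  proof -
    have "{x \<in> space (restrict_space borel {0..1}). g x \<le> t} \<in> sets (restrict_space borel {0..1})"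
      using assms(2)[OF that] by measurable
    then show ?thesis
      by (simp add: sets_restrict_space_iff space_restrict_space)
  qed
  have "{x \<in> {0..1}. f x \<le> t} \<in> null_sets lebesgue \<or> {x \<in> {0..1}. t < f x} \<in> null_sets lebesgue" for t
  proof (rule ccontr)
    define A where "A = {x \<in> {0..1}. f x \<le> t}"
    define B where "B = {x \<in> {0..1}. t < f x}"
    assume "\<not> ?thesis"
    then have not_null: "A \<notin> null_sets lebesgue" "B \<notin> null_sets lebesgue"
      by (auto simp: A_def B_def)
    have "A \<in> sets borel"
      unfolding A_def by (rule sublevel[OF assms(4)])
    moreover have "B = {0..1} - A"
      by (auto simp: A_def B_def)
    ultimately have meas: "A \<in> sets lebesgue" "B \<in> sets lebesgue"
      by auto
    have sub: "A \<subseteq> {0..1}" "B \<subseteq> {0..1}"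
      by (auto simp: A_def B_def)
    have continuum: "(UNIV :: real set) \<approx> X"
      if "X \<in> sets lebesgue" "X \<notin> null_sets lebesgue" "X \<subseteq> {0..1}" for X :: "real set"
    proof (rule lepoll_antisym)
      have bounded: "bounded X"
        using that(3) by (rule bounded_subset[OF bounded_closed_interval])
      then have X: "X \<in> lmeasurable"
        using that(1) by (rule bounded_set_imp_lmeasurable)
      have "measure lebesgue X \<noteq> 0"
        using X that(2) negligible_iff_measure negligible_iff_null_sets by blast
      then show "(UNIV :: real set) \<lesssim> X"
        using X bounded by (intro reals_lepoll_bounded_lmeasurable) (auto simp: zero_less_measure_iff)
    qed (simp add: subset_imp_lepoll)
    obtain N where N: "N \<subseteq> {0..1/3 :: real}" "N \<notin> sets lebesgue"
      using exists_not_lebesgue_subset_interval[of 0 "1/3"] by auto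
    \<comment> \<open>The added interval gives \<open>N'\<close> the size of the continuum, and the
      points between 2/3 and 1 do the same for its complement. It avoids \<open>{0..1/3}\<close>, so
      intersecting with that interval recovers \<open>N\<close>.\<close>
    define N' where "N' = N \<union> {1/2<..<2/3}"
    have N'_sub: "N' \<subseteq> {0..1}"
      using N(1) by (auto simp: N'_def)
    have "N' \<approx> (UNIV :: real set)"
      by (rule eqpoll_real_subset[of "1/2" "2/3"]) (auto simp: N'_def)
    then have NA: "N' \<approx> A"
      using continuum[OF meas(1) not_null(1) sub(1)] by (rule eqpoll_trans)
    have "{0..1} - N' \<approx> (UNIV :: real set)"
      using N(1) by (intro eqpoll_real_subset[of "2/3" 1]) (auto simp: N'_def)
    then have NB: "{0..1} - N' \<approx> B"
      using continuum[OF meas(2) not_null(2) sub(2)] by (rule eqpoll_trans)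
    have unions: "N' \<union> ({0..1} - N') = {0..1}" "A \<union> B = {0..1}"
      using N'_sub by (auto simp: A_def B_def)
    have AB: "A \<inter> B = {}"
      by (auto simp: A_def B_def)
    obtain \<sigma> where \<sigma>: "bij_betw \<sigma> {0..1} {0..1}" "\<And>x. x \<in> {0..1} \<Longrightarrow> \<sigma> x \<in> A \<longleftrightarrow> x \<in> N'"
      using bij_betw_if_eqpoll_parts[OF NA NB Diff_disjoint AB, unfolded unions] by blast
    have "compose {0..1} f \<sigma> \<in> F"
      using assms(3,4) \<sigma>(1) by (auto simp: permutation_closed_def interval_permutation_def)
    then have "{x \<in> {0..1}. compose {0..1} f \<sigma> x \<le> t} \<in> sets borel"
      by (rule sublevel)
    also have "{x \<in> {0..1}. compose {0..1} f \<sigma> x \<le> t} = N'"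
      using \<sigma>(2) bij_betwE[OF \<sigma>(1)] N'_sub by (auto simp: compose_def A_def)
    finally have "N' \<inter> {0..1/3} \<in> sets borel"
      by auto
    also have "N' \<inter> {0..1/3} = N"
      using N(1) by (auto simp: N'_def)
    finally show False
      using N(2) by simp
  qed
  moreover have "{0..1::real} \<notin> null_sets lebesgue"
    by (simp add: null_sets_def)
  ultimately show ?thesis
    using constant_AE_if_cuts_null by blast
qed

end
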